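(* Let $T$ be the symmetric tridiagonal operator determined by sequences $a_n>0$, $b_n\in\mathbb{R}$ ($n\ge 1$), and let $T_N$ be its orthogonal truncations. Suppose that there exist an infinite set $\mathcal{N}\subseteq\mathbb{N}$ of indices and, for each $N\in\mathcal{N}$, a vector $x_N\in H_N$ with $\|x_N\|=1$ and $T_Nx_N=\lambda_Nx_N$, such that the eigenvalues $\{\lambda_N\}_{N\in\mathcal{N}}$ form a bounded set and $$\lim_{N\to\infty,\;N\in\mathcal{N}} a_N\,(x_N,e_N)=0 .$$ Then $T$ is self-adjoint.
   Context: $(H,(\cdot,\cdot))$ is an infinite-dimensional complex Hilbert space with orthonormal basis $\{e_n\}_{n=1}^\infty$. Given real sequences $a_n>0$, $b_n\in\mathbb{R}$ ($n\ge1$), the formula $Te_n=a_ne_{n+1}+b_ne_n+a_{n-1}e_{n-1}$ (with $e_0=0$) defines a symmetric operator on the linear span of $\{e_n\}_{n=1}^\infty$; $T$ denotes the closure of this operator (the sequences may be unbounded). $H_N=\operatorname{span}\{e_1,\dots,e_N\}$, $P_N$ is the orthogonal projection onto $H_N$, and $T_N=P_NTP_N$ regarded as an operator on $H_N$ (its matrix in the basis $e_1,\dots,e_N$ is the symmetric tridiagonal matrix with diagonal $b_1,\dots,b_N$ and off-diagonal entries $a_1,\dots,a_{N-1}$). *)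

theory Defs
  imports "HOL-Analysis.Analysis"
begin

section \<open>Complex Hilbert spaces\<close>

text \<open>The inner product is linear in its first argument.\<close>

class complex_inner = real_normed_vector +
  fixes scaleC :: "complex \<Rightarrow> 'a \<Rightarrow> 'a"  (infixr \<open>*\<^sub>C\<close> 75)
    and cinner :: "'a \<Rightarrow> 'a \<Rightarrow> complex"
  assumes scaleC_add_right: "c *\<^sub>C (x + y) = c *\<^sub>C x + c *\<^sub>C y"
    and scaleC_add_left: "(c + d) *\<^sub>C x = c *\<^sub>C x + d *\<^sub>C x"
    and scaleC_scaleC: "c *\<^sub>C d *\<^sub>C x = (c * d) *\<^sub>C x"
    and scaleC_of_real: "complex_of_real r *\<^sub>C x = r *\<^sub>R x"
    and cinner_commute: "cinner x y = cnj (cinner y x)"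
    and cinner_add_left: "cinner (x + y) z = cinner x z + cinner y z"
    and cinner_scaleC_left: "cinner (c *\<^sub>C x) y = c * cinner x y"
    and cinner_self: "cinner x x = complex_of_real ((norm x)\<^sup>2)"

class complex_hilbert_space = complex_inner + complete_space

global_interpretation complex_vector: vector_space "scaleC :: complex \<Rightarrow> 'a \<Rightarrow> 'a::complex_inner"
proof
  show "1 *\<^sub>C x = x" for x :: 'a
    using scaleC_of_real[of 1 x] by simp
qed (simp_all add: scaleC_add_right scaleC_add_left scaleC_scaleC)

text \<open>The Hilbert sum of two spaces; graphs of operators live here.\<close>

instantiation prod :: (complex_inner, complex_inner) complex_inner
begin

definition "c *\<^sub>C p = (c *\<^sub>C fst p, c *\<^sub>C snd p)"

definition "cinner p q = cinner (fst p) (fst q) + cinner (snd p) (snd q)"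

instance
proof
  fix c d :: complex and r :: real and x y z :: "'a \<times> 'b"
  show "cinner x y = cnj (cinner y x)"
    unfolding cinner_prod_def complex_cnj_add using cinner_commute by metis
  show "cinner x x = complex_of_real ((norm x)\<^sup>2)"
    by (simp add: cinner_prod_def cinner_self norm_prod_def)
qed (simp_all add: scaleC_prod_def cinner_prod_def scaleC_add_right scaleC_add_left
      scaleC_scaleC scaleC_of_real scaleR_prod_def cinner_add_left cinner_scaleC_left algebra_simps)

end


section \<open>Unbounded operators\<close>

text \<open>
  A possibly unbounded, partially defined operator is identified with its graph, so that the
  domain is \<^const>\<open>Domain\<close> and the closure of an operator is the topological \<^const>\<open>closure\<close>.
\<close>

type_synonym 'a operator = "('a \<times> 'a) set"

definition linear_operator :: "'a::complex_inner operator \<Rightarrow> bool" where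
  "linear_operator T \<longleftrightarrow> complex_vector.subspace T \<and> single_valued T"

definition op_apply :: "'a operator \<Rightarrow> 'a \<Rightarrow> 'a" where
  "op_apply T x = (THE y. (x, y) \<in> T)"

text \<open>For densely defined \<open>T\<close> this relation is single-valued and is the graph of the adjoint.\<close>

definition op_adjoint :: "'a::complex_inner operator \<Rightarrow> 'a operator" where
  "op_adjoint T = {(y, z). \<forall>(x, w) \<in> T. cinner w y = cinner x z}"

definition self_adjoint :: "'a::complex_inner operator \<Rightarrow> bool" where
  "self_adjoint T \<longleftrightarrow>
     linear_operator T \<and> closure (Domain T) = UNIV \<and> op_adjoint T = T"

definition orthogonal_projection :: "'a::complex_inner set \<Rightarrow> 'a \<Rightarrow> 'a" where
  "orthogonal_projection M x = (THE y. y \<in> M \<and> (\<forall>z\<in>M. cinner (x - y) z = 0))"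


section \<open>Tridiagonal operators and their truncations\<close>

text \<open>All sequences are indexed from 1; their values at 0 are irrelevant.\<close>

definition orthonormal_basis :: "(nat \<Rightarrow> 'a::complex_inner) \<Rightarrow> bool" where
  "orthonormal_basis e \<longleftrightarrow>
     (\<forall>m\<ge>1. \<forall>n\<ge>1. cinner (e m) (e n) = (if m = n then 1 else 0)) \<and>
     closure (complex_vector.span (e ` {1..})) = UNIV"

definition tridiagonal_image ::
  "(nat \<Rightarrow> 'a::complex_inner) \<Rightarrow> (nat \<Rightarrow> real) \<Rightarrow> (nat \<Rightarrow> real) \<Rightarrow> nat \<Rightarrow> 'a" where
  "tridiagonal_image e a b n =
     a n *\<^sub>R e (n + 1) + b n *\<^sub>R e n + (if n = 1 then 0 else a (n - 1) *\<^sub>R e (n - 1))"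

text \<open>
  The span of the pairs \<open>(e\<^sub>n, T e\<^sub>n)\<close> is the graph of the linear extension of
  \<open>e\<^sub>n \<mapsto> T e\<^sub>n\<close> to the linear span of the basis.
\<close>

definition tridiagonal_operator_0 ::
  "(nat \<Rightarrow> 'a::complex_inner) \<Rightarrow> (nat \<Rightarrow> real) \<Rightarrow> (nat \<Rightarrow> real) \<Rightarrow> 'a operator" where
  "tridiagonal_operator_0 e a b =
     complex_vector.span ((\<lambda>n. (e n, tridiagonal_image e a b n)) ` {1..})"

lemma Domain_tridiagonal_operator_0:
  "Domain (tridiagonal_operator_0 e a b) = complex_vector.span (e ` {1..})"
proof -
  interpret L: Vector_Spaces.linear "scaleC :: complex \<Rightarrow> 'a \<times> 'a \<Rightarrow> _" "scaleC :: complex \<Rightarrow> 'a \<Rightarrow> _" fst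
    by unfold_locales (simp_all add: scaleC_prod_def)
  show ?thesis
    unfolding Domain_fst tridiagonal_operator_0_def
    by (simp add: L.span_image [symmetric] image_image)
qed

lemma cinner_zero_left [simp]: "cinner 0 (y :: 'a::complex_inner) = 0"
  using cinner_add_left[of 0 0 y] by simp

lemma cinner_zero_right [simp]: "cinner (x :: 'a::complex_inner) 0 = 0"
  by (subst cinner_commute) simp

lemma cinner_add_right: "cinner (x :: 'a::complex_inner) (y + z) = cinner x y + cinner x z"
  by (metis cinner_add_left cinner_commute complex_cnj_add)

lemma cinner_scaleC_right: "cinner (x :: 'a::complex_inner) (c *\<^sub>C y) = cnj c * cinner x y"
  by (metis cinner_commute cinner_scaleC_left complex_cnj_mult)

lemma cinner_scaleR_left: "cinner (r *\<^sub>R x :: 'a::complex_inner) y = complex_of_real r * cinner x y"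
  by (metis cinner_scaleC_left scaleC_of_real)

lemma tridiagonal_operator_0_symmetric:
  assumes "orthonormal_basis e"
    and "(x, x') \<in> tridiagonal_operator_0 e a b" and "(y, y') \<in> tridiagonal_operator_0 e a b"
  shows "cinner x' y = cinner x y'"
proof -
  let ?G = "(\<lambda>n. (e n, tridiagonal_image e a b n)) ` {1..}"
  have e: "cinner (e m) (e n) = (if m = n then 1 else 0)" if "m \<ge> 1" "n \<ge> 1" for m n
    using assms(1) that by (auto simp: orthonormal_basis_def)
  have basis: "cinner (snd p) (fst q) = cinner (fst p) (snd q)" if "p \<in> ?G" "q \<in> ?G" for p q
  proof -
    from that obtain m n where mn: "m \<ge> 1" "n \<ge> 1"
      and p: "p = (e m, tridiagonal_image e a b m)" and q: "q = (e n, tridiagonal_image e a b n)"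
      by auto
    have 1: "cinner (tridiagonal_image e a b i) (e j) =
        (if j = i + 1 then a i else 0) + (if j = i then b i else 0) + (if i = j + 1 then a j else 0)"
      if "i \<ge> 1" "j \<ge> 1" for i j
      using that
      by (cases "i = 1") (auto simp: tridiagonal_image_def cinner_add_left cinner_scaleR_left e)
    have "cinner (e m) (tridiagonal_image e a b n) = cnj (cinner (tridiagonal_image e a b n) (e m))"
      by (rule cinner_commute)
    then show ?thesis
      by (auto simp: p q 1[OF mn] 1[OF mn(2,1)])
  qed
  have left: "cinner (snd p) (fst q) = cinner (fst p) (snd q)"
    if "p \<in> complex_vector.span ?G" "q \<in> ?G" for p q
    using that(1)
    by (induction rule: complex_vector.span_induct_alt)
      (simp_all add: basis that scaleC_prod_def cinner_add_left cinner_scaleC_left del: One_nat_def)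
  have "cinner (snd p) (fst q) = cinner (fst p) (snd q)"
    if "q \<in> complex_vector.span ?G" "p \<in> complex_vector.span ?G" for p q
    using that(1)
    by (induction rule: complex_vector.span_induct_alt)
      (simp_all add: left that(2) scaleC_prod_def cinner_add_right cinner_scaleC_right
        del: One_nat_def)
  from this[of "(y, y')" "(x, x')"] show ?thesis
    using assms(2,3) by (simp add: tridiagonal_operator_0_def)
qed

definition tridiagonal_operator ::
  "(nat \<Rightarrow> 'a::complex_inner) \<Rightarrow> (nat \<Rightarrow> real) \<Rightarrow> (nat \<Rightarrow> real) \<Rightarrow> 'a operator" where
  "tridiagonal_operator e a b = closure (tridiagonal_operator_0 e a b)"

definition truncation_space :: "(nat \<Rightarrow> 'a::complex_inner) \<Rightarrow> nat \<Rightarrow> 'a set" where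
  "truncation_space e N = complex_vector.span (e ` {1..N})"

text \<open>\<open>P\<^sub>N T P\<^sub>N\<close>; as an operator on \<open>H\<^sub>N\<close> it is used only at arguments in \<open>H\<^sub>N\<close>.\<close>

definition truncation :: "(nat \<Rightarrow> 'a::complex_inner) \<Rightarrow> 'a operator \<Rightarrow> nat \<Rightarrow> 'a \<Rightarrow> 'a" where
  "truncation e T N x =
     (let P = orthogonal_projection (truncation_space e N) in P (op_apply T (P x)))"

end

theory Submission
  imports Defs
begin

text \<open>
  Let \<open>p\<^sub>n(z)\<close> be the solution of the three-term recurrence with \<open>p\<^sub>1 = 1\<close>.

  If \<open>\<Sum> |p\<^sub>n(\<i>)|\<^sup>2\<close> diverges, then \<open>T\<close> is self-adjoint: modulo the range of \<open>T\<^sub>0 \<mp> \<i>\<close> one has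
  \<open>e\<^sub>n \<equiv> p\<^sub>n(\<plusminus>\<i>) e\<^sub>1\<close>, so \<open>e\<^sub>1\<close> is congruent to vectors of norm \<open>(\<Sum>\<^bsub>k\<le>n\<^esub> |p\<^sub>k|\<^sup>2)\<^bsup>-1/2\<^esup> \<rightarrow> 0\<close>,
  and both ranges are dense.

  If the series converges, the hypotheses are contradictory. The Wronskians of \<open>x\<^sub>N\<close> with
  \<open>p(\<i>)\<close> and \<open>p(-\<i>)\<close> determine \<open>x\<^sub>N\<close>, because the Wronskian of \<open>p(-\<i>)\<close> and \<open>p(\<i>)\<close> at \<open>n\<close> is
  \<open>2\<i> \<Sum>\<^bsub>k\<le>n\<^esub> |p\<^sub>k(\<i>)|\<^sup>2\<close>, bounded away from \<open>0\<close>. At the right end \<open>n = N\<close> they are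
  \<open>a\<^sub>N (x\<^sub>N, e\<^sub>N) p\<^bsub>N+1\<^esub>(\<plusminus>\<i>)\<close>, and Gronwall's inequality, run backwards from \<open>N\<close>, gives
  \<open>|(x\<^sub>N, e\<^sub>n)| \<le> C a\<^sub>N |(x\<^sub>N, e\<^sub>N)| |p\<^sub>n(\<i>)|\<close> with \<open>C\<close> independent of \<open>N\<close>; hence \<open>\<parallel>x\<^sub>N\<parallel> \<rightarrow> 0\<close>.
\<close>

section \<open>Complex inner product spaces\<close>

lemma cinner_minus_left: "cinner (- x :: 'a::complex_inner) y = - cinner x y"
  using cinner_add_left[of x "- x" y] by (simp add: add_eq_0_iff)

lemma cinner_diff_left: "cinner (x - z :: 'a::complex_inner) y = cinner x y - cinner z y"
  using cinner_add_left[of x "- z" y] by (simp add: cinner_minus_left)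

lemma cinner_diff_right: "cinner (x :: 'a::complex_inner) (y - z) = cinner x y - cinner x z"
  by (metis cinner_diff_left cinner_commute complex_cnj_diff)

lemma cinner_sum_left: "cinner (sum f A :: 'a::complex_inner) y = (\<Sum>i\<in>A. cinner (f i) y)"
  by (induction A rule: infinite_finite_induct) (simp_all add: cinner_add_left)

lemma norm_scaleC: "norm (c *\<^sub>C x :: 'a::complex_inner) = cmod c * norm x"
proof -
  have "complex_of_real ((norm (c *\<^sub>C x))\<^sup>2) = (c * cnj c) * complex_of_real ((norm x)\<^sup>2)"
    unfolding cinner_self[symmetric] by (simp add: cinner_scaleC_left cinner_scaleC_right)
  also have "\<dots> = complex_of_real ((cmod c * norm x)\<^sup>2)"
    by (simp only: complex_norm_square[symmetric] of_real_mult[symmetric] power_mult_distrib)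
  finally have "(norm (c *\<^sub>C x))\<^sup>2 = (cmod c * norm x)\<^sup>2"
    by (simp only: of_real_eq_iff)
  then show ?thesis by (simp add: power2_eq_iff_nonneg)
qed

lemma Cauchy_Schwarz_cinner: "cmod (cinner x y) \<le> norm x * norm (y :: 'a::complex_inner)"
proof (cases "y = 0")
  case False
  define c where "c = cinner x y / complex_of_real ((norm y)\<^sup>2)"
  have cy: "c * complex_of_real ((norm y)\<^sup>2) = cinner x y"
    using False by (simp add: c_def)
  have "cinner (x - c *\<^sub>C y) (x - c *\<^sub>C y) = cinner x x - cnj c * cinner x y
      - c * cinner y x + c * (cnj c * cinner y y)"
    by (simp add: cinner_diff_left cinner_diff_right cinner_scaleC_left cinner_scaleC_right
        algebra_simps)
  also have "\<dots> = complex_of_real ((norm x)\<^sup>2) - c * cnj (cinner x y)"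
    using cy cinner_commute[of y x] by (simp add: cinner_self algebra_simps)
  also have "c * cnj (cinner x y) = complex_of_real ((cmod (cinner x y))\<^sup>2 / (norm y)\<^sup>2)"
    unfolding c_def of_real_divide by (simp only: complex_norm_square times_divide_eq_left)
  finally have "complex_of_real ((norm (x - c *\<^sub>C y))\<^sup>2)
      = complex_of_real ((norm x)\<^sup>2 - (cmod (cinner x y))\<^sup>2 / (norm y)\<^sup>2)"
    by (simp only: cinner_self of_real_diff)
  then have "(norm x)\<^sup>2 - (cmod (cinner x y))\<^sup>2 / (norm y)\<^sup>2 \<ge> 0"
    by (metis of_real_eq_iff zero_le_power2)
  then have "(cmod (cinner x y))\<^sup>2 \<le> (norm x * norm y)\<^sup>2"
    using False by (simp add: field_simps power_mult_distrib)
  then show ?thesis by (simp add: power2_le_iff_abs_le)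
qed simp

lemma bounded_bilinear_cinner: "bounded_bilinear (cinner :: 'a::complex_inner \<Rightarrow> 'a \<Rightarrow> complex)"
proof
  show "cinner x (r *\<^sub>R y) = r *\<^sub>R cinner x y" for x y :: 'a and r
    using cinner_scaleC_right[of x "complex_of_real r" y]
    by (simp add: scaleC_of_real scaleR_conv_of_real)
  show "\<exists>K. \<forall>a b :: 'a. cmod (cinner a b) \<le> norm a * norm b * K"
    using Cauchy_Schwarz_cinner by (intro exI[of _ 1]) auto
qed (simp_all add: cinner_add_left cinner_add_right cinner_scaleR_left scaleR_conv_of_real)

lemmas tendsto_cinner [tendsto_intros] = bounded_bilinear.tendsto[OF bounded_bilinear_cinner]

lemma bounded_linear_scaleC: "bounded_linear ((*\<^sub>C) c :: 'a::complex_inner \<Rightarrow> 'a)"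
proof
  show "c *\<^sub>C (r *\<^sub>R x) = r *\<^sub>R (c *\<^sub>C x)" for x :: 'a and r
    by (simp only: scaleC_of_real[symmetric] scaleC_scaleC mult.commute)
  show "\<exists>K. \<forall>x :: 'a. norm (c *\<^sub>C x) \<le> norm x * K"
    by (intro exI[of _ "cmod c"]) (simp add: norm_scaleC mult.commute)
qed (simp add: scaleC_add_right)

lemmas tendsto_scaleC [tendsto_intros] = bounded_linear.tendsto[OF bounded_linear_scaleC]

lemma subspace_closure:
  assumes "complex_vector.subspace (S :: 'a::complex_inner set)"
  shows "complex_vector.subspace (closure S)"
proof (rule complex_vector.subspaceI)
  show "0 \<in> closure S"
    using complex_vector.subspace_0[OF assms] closure_subset by blast
next
  fix x y assume "x \<in> closure S" "y \<in> closure S"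
  then obtain f g where "\<forall>n. f n \<in> S" "f \<longlonglongrightarrow> x" "\<forall>n. g n \<in> S" "g \<longlonglongrightarrow> y"
    unfolding closure_sequential by auto
  then have "\<forall>n. f n + g n \<in> S" "(\<lambda>n. f n + g n) \<longlonglongrightarrow> x + y"
    by (auto intro: complex_vector.subspace_add[OF assms] tendsto_intros)
  then show "x + y \<in> closure S"
    unfolding closure_sequential by (intro exI[of _ "\<lambda>n. f n + g n"]) simp
next
  fix c x assume "x \<in> closure S"
  then obtain f where "\<forall>n. f n \<in> S" "f \<longlonglongrightarrow> x"
    unfolding closure_sequential by auto
  then have "\<forall>n. c *\<^sub>C f n \<in> S" "(\<lambda>n. c *\<^sub>C f n) \<longlonglongrightarrow> c *\<^sub>C x"
    by (auto intro: complex_vector.subspace_scale[OF assms] tendsto_intros)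
  then show "c *\<^sub>C x \<in> closure S"
    unfolding closure_sequential by (intro exI[of _ "\<lambda>n. c *\<^sub>C f n"]) simp
qed

lemma orthogonal_dense_eq_0:
  assumes "closure S = UNIV" and "\<And>s. s \<in> S \<Longrightarrow> cinner s u = 0"
  shows "u = (0 :: 'a::complex_inner)"
proof -
  have "u \<in> closure S" using assms(1) by simp
  then obtain f where f: "\<forall>n. f n \<in> S" "f \<longlonglongrightarrow> u"
    unfolding closure_sequential by auto
  have "(\<lambda>n. cinner (f n) u) \<longlonglongrightarrow> cinner u u"
    by (intro tendsto_intros f)
  moreover have "(\<lambda>n. cinner (f n) u) = (\<lambda>n. 0)"
    using f(1) assms(2) by auto
  ultimately have "cinner u u = 0"
    using LIMSEQ_unique tendsto_const by metis
  then show ?thesis by (simp add: cinner_self)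
qed

section \<open>The three-term recurrence\<close>

text \<open>For positive \<open>a\<close> these are the orthonormal polynomials of the Jacobi
  matrix, indexed so that p_n has degree n - 1. The value 0 at index 0 lets the recurrence include
  its first row, where it removes the arbitrary \<open>a 0\<close>.\<close>

fun orthopoly :: "(nat \<Rightarrow> real) \<Rightarrow> (nat \<Rightarrow> real) \<Rightarrow> complex \<Rightarrow> nat \<Rightarrow> complex" where
  "orthopoly a b z 0 = 0"
| "orthopoly a b z (Suc 0) = 1"
| "orthopoly a b z (Suc (Suc n)) =
     ((z - b (Suc n)) * orthopoly a b z (Suc n) - a n * orthopoly a b z n) / a (Suc n)"

lemma cnj_orthopoly: "orthopoly a b (cnj z) n = cnj (orthopoly a b z n)"
  by (induction a b z n rule: orthopoly.induct) simp_all

lemma orthopoly_rec: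
  assumes "a (Suc n) \<noteq> 0"
  shows "a (Suc n) * orthopoly a b z (Suc (Suc n)) =
    (z - b (Suc n)) * orthopoly a b z (Suc n) - a n * orthopoly a b z n"
  using assms by simp

text \<open>A discrete Wronskian (Casoratian). The weight \<open>a n\<close> makes it independent of
  n wherever both sequences solve the recurrence with the same spectral parameter.\<close>

definition wronskian :: "(nat \<Rightarrow> real) \<Rightarrow> (nat \<Rightarrow> complex) \<Rightarrow> (nat \<Rightarrow> complex) \<Rightarrow> nat \<Rightarrow> complex" where
  "wronskian a u v n = a n * (u n * v (Suc n) - u (Suc n) * v n)"

text \<open>The terms with \<open>b\<close> cancel when the two recurrences are cross-multiplied, so
  only the difference of the spectral parameters survives. The recurrences are assumed at the single
  index n, so sequences solving them only up to N qualify.\<close>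

lemma wronskian_Suc:
  fixes a b :: "nat \<Rightarrow> real" and u v :: "nat \<Rightarrow> complex" and z w :: complex
  assumes u: "a (Suc n) * u (Suc (Suc n)) = (z - b (Suc n)) * u (Suc n) - a n * u n"
    and v: "a (Suc n) * v (Suc (Suc n)) = (w - b (Suc n)) * v (Suc n) - a n * v n"
  shows "wronskian a u v (Suc n) = wronskian a u v n + (w - z) * u (Suc n) * v (Suc n)"
proof -
  have "wronskian a u v (Suc n) =
      u (Suc n) * (a (Suc n) * v (Suc (Suc n))) - (a (Suc n) * u (Suc (Suc n))) * v (Suc n)"
    by (simp add: wronskian_def algebra_simps)
  then show ?thesis
    unfolding u v by (simp add: wronskian_def algebra_simps)
qed

text \<open>\<open>wronskian_Suc\<close> telescopes from index 0, where both solutions vanish. Real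
  coefficients turn the product of the values at z and at its conjugate into a squared
  modulus.\<close>

lemma christoffel_darboux:
  assumes "\<And>n. n \<ge> 1 \<Longrightarrow> a n \<noteq> 0"
  shows "wronskian a (orthopoly a b (cnj z)) (orthopoly a b z) n =
    (z - cnj z) * complex_of_real (\<Sum>k=1..n. (cmod (orthopoly a b z k))\<^sup>2)"
proof (induction n)
  case (Suc n)
  have "wronskian a (orthopoly a b (cnj z)) (orthopoly a b z) (Suc n) =
      wronskian a (orthopoly a b (cnj z)) (orthopoly a b z) n +
      (z - cnj z) * orthopoly a b (cnj z) (Suc n) * orthopoly a b z (Suc n)"
    using assms by (intro wronskian_Suc[where b = b] orthopoly_rec) auto
  also have "\<dots> = wronskian a (orthopoly a b (cnj z)) (orthopoly a b z) n +
      (z - cnj z) * complex_of_real ((cmod (orthopoly a b z (Suc n)))\<^sup>2)"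
    by (simp only: cnj_orthopoly complex_norm_square mult.assoc mult.commute mult.left_commute)
  finally show ?case
    by (simp add: Suc.IH algebra_simps)
qed (simp add: wronskian_def)

text \<open>Variation of constants, started at the right end: square summability of p transfers to
  \<xi>, with a factor that depends on N only through \<open>cmod (a N * \<xi> N)\<close>.\<close>

lemma truncated_eigenvector_bound:
  fixes a b :: "nat \<Rightarrow> real" and \<xi> :: "nat \<Rightarrow> complex" and \<mu> :: complex
  defines "p \<equiv> orthopoly a b \<i>"
  assumes a: "\<And>n. n \<ge> 1 \<Longrightarrow> a n \<noteq> 0"
    and rec: "\<And>n. n < N \<Longrightarrow>
      a (Suc n) * \<xi> (Suc (Suc n)) = (\<mu> - b (Suc n)) * \<xi> (Suc n) - a n * \<xi> n"
    and end0: "\<xi> (Suc N) = 0"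
    and P: "\<And>n. (\<Sum>k=1..n. (cmod (p k))\<^sup>2) \<le> P"
    and K: "cmod \<mu> \<le> K"
    and n: "1 \<le> n" "n \<le> N"
  shows "cmod (\<xi> n) \<le> cmod (p n) * (cmod (a N * \<xi> N) * sqrt P * exp ((K + 1) * P))"
proof -
  define q where "q = orthopoly a b (- \<i>)"
  have q: "q k = cnj (p k)" for k
    using cnj_orthopoly[of a b \<i> k] by (simp add: p_def q_def)
  define \<delta> where "\<delta> = cmod (a N * \<xi> N) * sqrt P"
  \<comment> \<open>\<open>y n\<close> will majorize both Wronskians at n. Its sum starts at n + 1,
    so it involves only later entries of \<xi>; bounding \<open>\<xi> n\<close> by
    \<open>y n\<close> therefore closes into a backward recursion.\<close>
  define y where "y n = \<delta> + (K + 1) * (\<Sum>k=Suc n..N. cmod (\<xi> k) * cmod (p k))" for n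
  have K0: "K \<ge> 0" using K norm_ge_zero order_trans by blast
  have d0: "\<delta> \<ge> 0" using P[of 0] by (simp add: \<delta>_def)
  have pN: "cmod (p k) \<le> sqrt P" for k
  proof (cases "k = 0")
    case True
    then show ?thesis using P[of 0] by (simp add: p_def)
  next
    case False
    have "(cmod (p k))\<^sup>2 \<le> (\<Sum>k=1..k. (cmod (p k))\<^sup>2)"
      using False by (intro member_le_sum) auto
    then show ?thesis using P[of k] by (intro real_le_rsqrt) linarith
  qed
  have y_step: "y n = y (Suc n) + (K + 1) * (cmod (\<xi> (Suc n)) * cmod (p (Suc n)))" if "n < N" for n
    using that by (simp add: y_def sum.atLeast_Suc_atMost[of "Suc n" N] distrib_left)
  \<comment> \<open>One statement serves both v = p(\<i>) and v = p(-\<i>), whose entries have equal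
    moduli; K + 1 bounds the difference of the spectral parameters w and \<mu>.\<close>
  have W: "cmod (wronskian a \<xi> v n) \<le> y n"
    if n: "n \<le> N" and v: "v = orthopoly a b w" and w: "cmod w \<le> 1"
      and vp: "\<And>k. cmod (v k) = cmod (p k)" for v w n
    using n
  proof (induction rule: inc_induct)
    case base
    \<comment> \<open>The boundary value \<open>\<xi> (Suc N) = 0\<close> leaves a single term, and
      |p_{N+1}| \<le> sqrt P reduces it to \<delta>.\<close>
    have "cmod (wronskian a \<xi> v N) = cmod (a N * \<xi> N) * cmod (p (Suc N))"
      by (simp add: wronskian_def end0 norm_mult vp mult_ac)
    also have "\<dots> \<le> \<delta>"
      unfolding \<delta>_def by (intro mult_left_mono pN) simp
    finally show ?case by (simp add: y_def)
  next
    case (step n)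
    have "wronskian a \<xi> v (Suc n) = wronskian a \<xi> v n + (w - \<mu>) * \<xi> (Suc n) * v (Suc n)"
      unfolding v using step(2) a by (intro wronskian_Suc[where b = b] rec orthopoly_rec) auto
    then have "cmod (wronskian a \<xi> v n) \<le>
        cmod (wronskian a \<xi> v (Suc n)) + cmod ((w - \<mu>) * \<xi> (Suc n) * v (Suc n))"
      by (metis add_diff_cancel_right' norm_triangle_ineq4)
    also have "cmod ((w - \<mu>) * \<xi> (Suc n) * v (Suc n)) =
        cmod (w - \<mu>) * (cmod (\<xi> (Suc n)) * cmod (p (Suc n)))"
      by (simp add: norm_mult vp)
    also have "\<dots> \<le> (K + 1) * (cmod (\<xi> (Suc n)) * cmod (p (Suc n)))"
      using norm_triangle_ineq4[of w \<mu>] w K by (intro mult_right_mono) auto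
    finally show ?case using step y_step[of n] by simp
  qed
  have xi_le: "cmod (\<xi> n) \<le> cmod (p n) * y n" if n: "1 \<le> n" "n \<le> N" for n
  proof -
    define S where "S = (\<Sum>k=1..n. (cmod (p k))\<^sup>2)"
    have "(cmod (p 1))\<^sup>2 \<le> S"
      unfolding S_def using n by (intro member_le_sum) auto
    then have S: "S \<ge> 1" by (simp add: p_def)
    have cd: "wronskian a q p n = 2 * \<i> * S"
      using christoffel_darboux[of a b \<i> n] a by (simp add: p_def q_def S_def)
    have Wp: "cmod (wronskian a \<xi> p n) \<le> y n"
      by (rule W[OF n(2) p_def[THEN meta_eq_to_obj_eq]]) simp_all
    have Wq: "cmod (wronskian a \<xi> q n) \<le> y n"
      by (rule W[OF n(2) q_def]) (simp_all add: q)
    have "2 * \<i> * S * \<xi> n = q n * wronskian a \<xi> p n - p n * wronskian a \<xi> q n"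
      unfolding cd[symmetric] by (simp add: wronskian_def algebra_simps)
    then have "cmod (2 * \<i> * S * \<xi> n) \<le>
        cmod (q n * wronskian a \<xi> p n) + cmod (p n * wronskian a \<xi> q n)"
      by (metis norm_triangle_ineq4)
    also have "\<dots> \<le> cmod (p n) * y n + cmod (p n) * y n"
      unfolding norm_mult q[of n] complex_mod_cnj
      by (intro add_mono mult_left_mono Wp Wq norm_ge_zero)
    finally have "S * cmod (\<xi> n) \<le> cmod (p n) * y n"
      using S by (simp add: norm_mult mult.commute)
    moreover have "1 * cmod (\<xi> n) \<le> S * cmod (\<xi> n)"
      using S by (intro mult_right_mono) auto
    ultimately show ?thesis by simp
  qed
  \<comment> \<open>The bound on \<xi> at n + 1 gives y_n \<le> y_{n+1} (1 + (K + 1) |p_{n+1}|^2),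
    and 1 + t \<le> exp t combines these factors into one exponential.\<close>
  have gronwall: "y n \<le> \<delta> * exp ((K + 1) * (\<Sum>k=Suc n..N. (cmod (p k))\<^sup>2))" if "n \<le> N" for n
    using that
  proof (induction rule: inc_induct)
    case (step n)
    have y0: "y (Suc n) \<ge> 0"
      unfolding y_def using d0 K0 by (intro add_nonneg_nonneg mult_nonneg_nonneg sum_nonneg) auto
    have "y n \<le> y (Suc n) + (K + 1) * (cmod (p (Suc n)) * y (Suc n) * cmod (p (Suc n)))"
      unfolding y_step[OF step(2)] using step(2) K0
      by (intro add_left_mono mult_left_mono mult_right_mono xi_le) auto
    also have "\<dots> = y (Suc n) * (1 + (K + 1) * (cmod (p (Suc n)))\<^sup>2)"
      by (simp add: algebra_simps power2_eq_square)
    also have "\<dots> \<le> y (Suc n) * exp ((K + 1) * (cmod (p (Suc n)))\<^sup>2)"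
      by (intro mult_left_mono exp_ge_add_one_self y0)
    also have "\<dots> \<le> \<delta> * exp ((K + 1) * (\<Sum>k=Suc (Suc n)..N. (cmod (p k))\<^sup>2)) *
        exp ((K + 1) * (cmod (p (Suc n)))\<^sup>2)"
      by (intro mult_right_mono step.IH) auto
    also have "\<dots> = \<delta> * exp ((K + 1) * (\<Sum>k=Suc n..N. (cmod (p k))\<^sup>2))"
      using step(2)
      by (simp add: sum.atLeast_Suc_atMost[of "Suc n" N] distrib_left exp_add mult_ac)
    finally show ?case .
  qed (simp add: y_def)
  have "(\<Sum>k=Suc n..N. (cmod (p k))\<^sup>2) \<le> (\<Sum>k=1..N. (cmod (p k))\<^sup>2)"
    by (intro sum_mono2) auto
  then have "(\<Sum>k=Suc n..N. (cmod (p k))\<^sup>2) \<le> P"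
    using P[of N] by linarith
  then have "y n \<le> \<delta> * exp ((K + 1) * P)"
    using gronwall[OF n(2)] d0 K0
    by (meson exp_le_cancel_iff mult_left_mono order_trans add_nonneg_nonneg zero_le_one)
  then show ?thesis
    using xi_le[OF n] unfolding \<delta>_def by (meson mult_left_mono norm_ge_zero order_trans)
qed

section \<open>The tridiagonal operator\<close>

locale tridiagonal =
  fixes e :: "nat \<Rightarrow> 'a::complex_hilbert_space" and a b :: "nat \<Rightarrow> real"
  assumes basis: "orthonormal_basis e" and a_pos: "n \<ge> 1 \<Longrightarrow> a n > 0"
begin

abbreviation "T\<^sub>0 \<equiv> tridiagonal_operator_0 e a b"
abbreviation "T \<equiv> tridiagonal_operator e a b"

section \<open>The closure as a symmetric, densely defined operator\<close>

lemma cinner_e: "m \<ge> 1 \<Longrightarrow> n \<ge> 1 \<Longrightarrow> cinner (e m) (e n) = (if m = n then 1 else 0)"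
  using basis by (auto simp: orthonormal_basis_def)

lemma dense_span: "closure (complex_vector.span (e ` {1..})) = UNIV"
  using basis by (simp add: orthonormal_basis_def)

lemma subspace_T0: "complex_vector.subspace T\<^sub>0"
  by (simp add: tridiagonal_operator_0_def)

lemma subspace_T: "complex_vector.subspace T"
  by (simp add: tridiagonal_operator_def subspace_closure subspace_T0)

lemma T0_subset_T: "T\<^sub>0 \<subseteq> T"
  by (simp add: tridiagonal_operator_def closure_subset)

lemma e_in_T0: "n \<ge> 1 \<Longrightarrow> (e n, tridiagonal_image e a b n) \<in> T\<^sub>0"
  unfolding tridiagonal_operator_0_def by (intro complex_vector.span_base) auto

lemma T_sequential:
  assumes "(x, w) \<in> T"
  obtains f g where "\<And>n. (f n, g n) \<in> T\<^sub>0" "f \<longlonglongrightarrow> x" "g \<longlonglongrightarrow> w"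
proof -
  from assms obtain h where h: "\<forall>n. h n \<in> T\<^sub>0" "h \<longlonglongrightarrow> (x, w)"
    unfolding tridiagonal_operator_def closure_sequential by auto
  show ?thesis
  proof
    show "(fst (h n), snd (h n)) \<in> T\<^sub>0" for n using h by simp
    show "(\<lambda>n. fst (h n)) \<longlonglongrightarrow> x" "(\<lambda>n. snd (h n)) \<longlonglongrightarrow> w"
      using tendsto_fst[OF h(2)] tendsto_snd[OF h(2)] by auto
  qed
qed

lemma T_symmetric:
  assumes "(x, w) \<in> T" and "(y, v) \<in> T"
  shows "cinner w y = cinner x v"
proof -
  obtain f g where fg: "\<And>n. (f n, g n) \<in> T\<^sub>0" "f \<longlonglongrightarrow> x" "g \<longlonglongrightarrow> w"
    using T_sequential[OF assms(1)] by blast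
  obtain f' g' where fg': "\<And>n. (f' n, g' n) \<in> T\<^sub>0" "f' \<longlonglongrightarrow> y" "g' \<longlonglongrightarrow> v"
    using T_sequential[OF assms(2)] by blast
  have "(\<lambda>n. cinner (g n) (f' n)) \<longlonglongrightarrow> cinner w y" "(\<lambda>n. cinner (f n) (g' n)) \<longlonglongrightarrow> cinner x v"
    by (intro tendsto_intros fg fg')+
  moreover have "cinner (g n) (f' n) = cinner (f n) (g' n)" for n
    by (rule tridiagonal_operator_0_symmetric[OF basis fg(1) fg'(1)])
  ultimately show ?thesis
    using LIMSEQ_unique by fastforce
qed

lemma Domain_T_dense: "closure (Domain T) = UNIV"
proof -
  have "complex_vector.span (e ` {1..}) \<subseteq> Domain T"
    using Domain_tridiagonal_operator_0[of e a b] T0_subset_T by blast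
  then show ?thesis
    using dense_span closure_mono by blast
qed

text \<open>By symmetry, two images of the same vector differ by something orthogonal to the dense
  domain. This makes \<open>op_apply T\<close> meaningful on the domain.\<close>

lemma single_valued_T: "single_valued T"
proof (rule single_valuedI)
  fix x w w' assume *: "(x, w) \<in> T" "(x, w') \<in> T"
  have "cinner s (w - w') = 0" if "s \<in> Domain T" for s
  proof -
    from that obtain t where "(s, t) \<in> T" by blast
    then have "cinner t x = cinner s w" "cinner t x = cinner s w'"
      using * T_symmetric by blast+
    then show ?thesis by (simp add: cinner_diff_right)
  qed
  then show "w = w'"
    using orthogonal_dense_eq_0[OF Domain_T_dense] by fastforce
qed

lemma linear_operator_T: "linear_operator T"
  by (simp add: linear_operator_def subspace_T single_valued_T)

lemma op_apply_T: "(x, w) \<in> T \<Longrightarrow> op_apply T x = w"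
  unfolding op_apply_def using single_valued_T by (auto simp: single_valued_def)

section \<open>Divergent series: dense ranges and self-adjointness\<close>

definition shifted_range :: "complex \<Rightarrow> 'a set" where
  "shifted_range z = (\<lambda>(x, w). w - z *\<^sub>C x) ` T\<^sub>0"

lemma subspace_shifted_range: "complex_vector.subspace (shifted_range z)"
proof (rule complex_vector.subspaceI)
  show "0 \<in> shifted_range z"
    using complex_vector.subspace_0[OF subspace_T0]
    by (force simp: shifted_range_def zero_prod_def)
next
  fix u v assume "u \<in> shifted_range z" "v \<in> shifted_range z"
  then obtain x w y t where *: "(x, w) \<in> T\<^sub>0" "u = w - z *\<^sub>C x" "(y, t) \<in> T\<^sub>0" "v = t - z *\<^sub>C y"
    by (auto simp: shifted_range_def)
  have "(x + y, w + t) \<in> T\<^sub>0"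
    using complex_vector.subspace_add[OF subspace_T0 *(1,3)] by simp
  moreover have "u + v = (w + t) - z *\<^sub>C (x + y)"
    by (simp add: * scaleC_add_right)
  ultimately show "u + v \<in> shifted_range z"
    by (force simp: shifted_range_def)
next
  fix c u assume "u \<in> shifted_range z"
  then obtain x w where *: "(x, w) \<in> T\<^sub>0" "u = w - z *\<^sub>C x"
    by (auto simp: shifted_range_def)
  have "(c *\<^sub>C x, c *\<^sub>C w) \<in> T\<^sub>0"
    using complex_vector.subspace_scale[OF subspace_T0 *(1)] by (simp add: scaleC_prod_def)
  moreover have "c *\<^sub>C u = c *\<^sub>C w - z *\<^sub>C (c *\<^sub>C x)"
    by (simp add: * complex_vector.scale_right_diff_distrib scaleC_scaleC mult.commute)
  ultimately show "c *\<^sub>C u \<in> shifted_range z"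
    by (force simp: shifted_range_def)
qed

text \<open>Modulo the range of \<open>T\<^sub>0 - z\<close> the basis vectors satisfy the recurrence of the \<open>p\<^sub>n(z)\<close>.\<close>

lemma e_cong_mod_range:
  assumes "n \<ge> 1"
  shows "e n - orthopoly a b z n *\<^sub>C e 1 \<in> shifted_range z"
proof -
  \<comment> \<open>\<open>f 0 = 0\<close> matches p_0 = 0 and makes the image of
    \<open>e (Suc n)\<close> uniform in n, with n = 0 included. The recurrence has order two, so the
    induction carries two consecutive members of d.\<close>
  define f where "f n = (if n = 0 then 0 else e n)" for n
  define d where "d n = f n - orthopoly a b z n *\<^sub>C e 1" for n
  note sub = subspace_shifted_range[of z]
  have "d n \<in> shifted_range z \<and> d (Suc n) \<in> shifted_range z" for n
  proof (induction n)
    case 0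
    then show ?case
      using complex_vector.subspace_0[OF sub] by (simp add: d_def f_def)
  next
    case (Suc n)
    let ?p = "orthopoly a b z" and ?A = "complex_of_real (a (Suc n))"
    let ?r = "tridiagonal_image e a b (Suc n) - z *\<^sub>C e (Suc n)"
    have r: "?r \<in> shifted_range z"
      unfolding shifted_range_def using e_in_T0[of "Suc n"] by force
    have A: "?A \<noteq> 0" using a_pos[of "Suc n"] by simp
    have im: "tridiagonal_image e a b (Suc n) =
        ?A *\<^sub>C f (Suc (Suc n)) + complex_of_real (b (Suc n)) *\<^sub>C f (Suc n) + complex_of_real (a n) *\<^sub>C f n"
      by (simp add: tridiagonal_image_def f_def scaleC_of_real)
    have "?A *\<^sub>C d (Suc (Suc n)) = ?A *\<^sub>C f (Suc (Suc n)) - (?A * ?p (Suc (Suc n))) *\<^sub>C e 1"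
      by (simp add: d_def complex_vector.scale_right_diff_distrib scaleC_scaleC)
    also have "\<dots> = ?r + (z - b (Suc n)) *\<^sub>C d (Suc n) - complex_of_real (a n) *\<^sub>C d n"
      unfolding im orthopoly_rec[where a = a and n = n, OF A[unfolded of_real_eq_0_iff]]
      by (simp add: d_def f_def complex_vector.scale_right_diff_distrib
          complex_vector.scale_left_diff_distrib scaleC_scaleC algebra_simps del: orthopoly.simps)
    also have "\<dots> \<in> shifted_range z"
      using Suc.IH by (intro complex_vector.subspace_diff[OF sub] r
          complex_vector.subspace_add[OF sub r] complex_vector.subspace_scale[OF sub]) auto
    finally have "inverse ?A *\<^sub>C ?A *\<^sub>C d (Suc (Suc n)) \<in> shifted_range z"
      by (rule complex_vector.subspace_scale[OF sub])
    then show ?case using A Suc.IH by (simp add: scaleC_scaleC)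
  qed
  then have "d n \<in> shifted_range z" by blast
  then show ?thesis using assms by (simp add: d_def f_def)
qed

lemma norm_sum_e:
  "(norm (\<Sum>k=1..n. c k *\<^sub>C e k))\<^sup>2 = (\<Sum>k=1..n. (cmod (c k))\<^sup>2)"
proof -
  have "cinner (e j) (\<Sum>k=1..n. c k *\<^sub>C e k) = cnj (c j)" if "j \<in> {1..n}" for j
  proof -
    have "cinner (\<Sum>k=1..n. c k *\<^sub>C e k) (e j) = (\<Sum>k=1..n. if k = j then c k else 0)"
      unfolding cinner_sum_left using that
      by (intro sum.cong) (auto simp: cinner_scaleC_left cinner_e)
    then show ?thesis using that by (subst cinner_commute) simp
  qed
  then have "cinner (\<Sum>k=1..n. c k *\<^sub>C e k) (\<Sum>k=1..n. c k *\<^sub>C e k) = (\<Sum>k=1..n. c k * cnj (c k))"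
    by (subst cinner_sum_left) (simp add: cinner_scaleC_left)
  then have "complex_of_real ((norm (\<Sum>k=1..n. c k *\<^sub>C e k))\<^sup>2) =
      complex_of_real (\<Sum>k=1..n. (cmod (c k))\<^sup>2)"
    by (simp only: cinner_self complex_norm_square[symmetric] of_real_sum)
  then show ?thesis by (simp only: of_real_eq_iff)
qed

lemma shifted_range_dense:
  assumes unb: "\<And>P. \<exists>n. (\<Sum>k=1..n. (cmod (orthopoly a b z k))\<^sup>2) > P"
  shows "closure (shifted_range z) = UNIV"
proof -
  define p where "p = orthopoly a b z"
  note sub = subspace_shifted_range[of z]
  have "e 1 \<in> closure (shifted_range z)"
    unfolding closure_approachable
  proof (intro allI impI)
    fix \<epsilon> :: real assume \<epsilon>: "\<epsilon> > 0"
    obtain n where n: "(\<Sum>k=1..n. (cmod (p k))\<^sup>2) > (1 / \<epsilon>)\<^sup>2"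
      using unb unfolding p_def by blast
    define S where "S = (\<Sum>k=1..n. (cmod (p k))\<^sup>2)"
    \<comment> \<open>The weights cnj p_k turn the congruences of e_k with p_k e_1 into one of v
      with S e_1, while v has norm sqrt S. So e_1 lies within 1 / sqrt S of the range, which
      explains the threshold (1 / \<epsilon>)^2.\<close>
    define v where "v = (\<Sum>k=1..n. cnj (p k) *\<^sub>C e k)"
    have S: "S > (1 / \<epsilon>)\<^sup>2" using n by (simp add: S_def)
    then have S0: "S > 0" by (meson le_less_trans zero_le_power2)
    have "(\<Sum>k=1..n. cnj (p k) *\<^sub>C (e k - p k *\<^sub>C e 1)) \<in> shifted_range z"
      unfolding p_def by (intro complex_vector.subspace_sum[OF sub]
          complex_vector.subspace_scale[OF sub] e_cong_mod_range) auto
    also have "(\<Sum>k=1..n. cnj (p k) *\<^sub>C (e k - p k *\<^sub>C e 1)) = v - complex_of_real S *\<^sub>C e 1"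
      unfolding v_def S_def of_real_sum complex_norm_square complex_vector.scale_sum_left
      by (simp add: complex_vector.scale_right_diff_distrib scaleC_scaleC sum_subtractf mult.commute)
    finally have "(- complex_of_real (1 / S)) *\<^sub>C (v - complex_of_real S *\<^sub>C e 1) \<in> shifted_range z"
      by (rule complex_vector.subspace_scale[OF sub])
    moreover have "(- complex_of_real (1 / S)) *\<^sub>C (v - complex_of_real S *\<^sub>C e 1) =
        e 1 - complex_of_real (1 / S) *\<^sub>C v"
      using S0 by (simp add: complex_vector.scale_right_diff_distrib scaleC_scaleC)
    moreover have "dist (e 1 - complex_of_real (1 / S) *\<^sub>C v) (e 1) < \<epsilon>"
    proof -
      have "(norm v)\<^sup>2 = S"
        unfolding v_def S_def by (subst norm_sum_e) simp
      then have "norm v = sqrt S" by (metis norm_ge_zero real_sqrt_abs abs_of_nonneg)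
      then have "dist (e 1 - complex_of_real (1 / S) *\<^sub>C v) (e 1) = 1 / sqrt S"
        using S0 by (simp add: dist_norm norm_scaleC norm_divide real_div_sqrt
            divide_simps)
      also have "\<dots> < \<epsilon>"
      proof -
        have "1 / \<epsilon> < sqrt S" using S by (rule real_less_rsqrt)
        then show ?thesis using \<epsilon> S0 by (simp add: field_simps)
      qed
      finally show ?thesis .
    qed
    ultimately show "\<exists>y\<in>shifted_range z. dist y (e 1) < \<epsilon>" by metis
  qed
  \<comment> \<open>Each e_n is congruent to p_n e_1, so a closed subspace that contains the range
    and e_1 contains every e_n.\<close>
  moreover note csub = subspace_closure[OF sub]
  ultimately have "e n \<in> closure (shifted_range z)" if "n \<ge> 1" for n
    using complex_vector.subspace_add[OF csub, of "e n - p n *\<^sub>C e 1" "p n *\<^sub>C e 1"]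
      e_cong_mod_range[OF that, of z] closure_subset complex_vector.subspace_scale[OF csub]
    unfolding p_def by auto
  then have "complex_vector.span (e ` {1..}) \<subseteq> closure (shifted_range z)"
    by (intro complex_vector.span_minimal csub) auto
  then show ?thesis
    using dense_span closure_minimal[OF _ closed_closure] by blast
qed

text \<open>Symmetry cancels the cross terms: the squared norm of w - \<i>x is the sum of those of w
  and x. Hence convergence of images under T_0 - \<i> forces their preimages to be Cauchy.\<close>

lemma norm_shifted:
  assumes "(x, w) \<in> T\<^sub>0"
  shows "norm x \<le> norm (w - \<i> *\<^sub>C x)"
proof -
  have sym: "cinner w x = cinner x w"
    by (rule tridiagonal_operator_0_symmetric[OF basis assms assms])
  have "cinner (w - \<i> *\<^sub>C x) (w - \<i> *\<^sub>C x) = cinner w w + cinner x x"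
    by (simp add: cinner_diff_left cinner_diff_right cinner_scaleC_left cinner_scaleC_right sym
        algebra_simps)
  then have "complex_of_real ((norm (w - \<i> *\<^sub>C x))\<^sup>2) = complex_of_real ((norm w)\<^sup>2 + (norm x)\<^sup>2)"
    by (simp only: cinner_self of_real_add)
  then have "(norm x)\<^sup>2 \<le> (norm (w - \<i> *\<^sub>C x))\<^sup>2"
    by (simp only: of_real_eq_iff) simp
  then show ?thesis by (simp add: power2_le_iff_abs_le)
qed

text \<open>The basic criterion: if the adjoint sends y to v, solve (T - \<i>)x = v - \<i>y with x
  in the domain of T. Then y - x is orthogonal to the dense range of T_0 + \<i>, so y = x.\<close>

lemma self_adjoint_T:
  assumes unb: "\<And>P. \<exists>n. (\<Sum>k=1..n. (cmod (orthopoly a b \<i> k))\<^sup>2) > P"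
  shows "self_adjoint T"
proof -
  \<comment> \<open>The hypothesis at \<i> also covers -\<i>, because the values of the polynomials
    there are complex conjugates.\<close>
  have dense: "closure (shifted_range \<i>) = UNIV" "closure (shifted_range (- \<i>)) = UNIV"
    using unb cnj_orthopoly[of a b \<i>] by (auto intro!: shifted_range_dense)
  have "T \<subseteq> op_adjoint T"
    by (auto simp: op_adjoint_def intro: T_symmetric)
  moreover have "(y, v) \<in> T" if adj: "(y, v) \<in> op_adjoint T" for y v
  proof -
    have "v - \<i> *\<^sub>C y \<in> closure (shifted_range \<i>)" using dense by simp
    then obtain g where g: "\<forall>n. g n \<in> shifted_range \<i>" "g \<longlonglongrightarrow> v - \<i> *\<^sub>C y"
      unfolding closure_sequential by auto
    from g(1) have "\<forall>n. \<exists>xw \<in> T\<^sub>0. g n = snd xw - \<i> *\<^sub>C fst xw"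
      by (force simp: shifted_range_def)
    then obtain h where h: "\<And>n. h n \<in> T\<^sub>0" "\<And>n. g n = snd (h n) - \<i> *\<^sub>C fst (h n)"
      by metis
    have "Cauchy (\<lambda>n. fst (h n))"
    proof (rule CauchyI)
      fix \<epsilon> :: real assume "\<epsilon> > 0"
      then obtain M where M: "\<forall>m\<ge>M. \<forall>n\<ge>M. norm (g m - g n) < \<epsilon>"
        using CauchyD LIMSEQ_imp_Cauchy[OF g(2)] by blast
      have "norm (fst (h m) - fst (h n)) \<le> norm (g m - g n)" for m n
      proof -
        have "h m - h n \<in> T\<^sub>0"
          by (intro complex_vector.subspace_diff subspace_T0 h)
        then have "(fst (h m - h n), snd (h m - h n)) \<in> T\<^sub>0"
          by (simp only: prod.collapse)
        then have "norm (fst (h m - h n)) \<le> norm (snd (h m - h n) - \<i> *\<^sub>C fst (h m - h n))"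
          by (rule norm_shifted)
        also have "snd (h m - h n) - \<i> *\<^sub>C fst (h m - h n) = g m - g n"
          by (simp add: h(2) complex_vector.scale_right_diff_distrib)
        finally show ?thesis by simp
      qed
      then show "\<exists>M. \<forall>m\<ge>M. \<forall>n\<ge>M. norm (fst (h m) - fst (h n)) < \<epsilon>"
        using M le_less_trans by blast
    qed
    then obtain x where x: "(\<lambda>n. fst (h n)) \<longlonglongrightarrow> x"
      using Cauchy_convergent convergentD by blast
    \<comment> \<open>The image is forced by w - \<i>x = v - \<i>y; closedness of T then puts (x, w)
      in it.\<close>
    define w where "w = v - \<i> *\<^sub>C y + \<i> *\<^sub>C x"
    have "(\<lambda>n. g n + \<i> *\<^sub>C fst (h n)) \<longlonglongrightarrow> w"
      unfolding w_def by (intro tendsto_intros g x)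
    then have "(\<lambda>n. snd (h n)) \<longlonglongrightarrow> w" by (simp add: h(2))
    then have "(\<lambda>n. (fst (h n), snd (h n))) \<longlonglongrightarrow> (x, w)"
      by (intro tendsto_Pair x)
    then have xw: "(x, w) \<in> T"
      unfolding tridiagonal_operator_def closure_sequential using h(1) by auto
    have "cinner s (y - x) = 0" if "s \<in> shifted_range (- \<i>)" for s
    proof -
      from that obtain u t where ut: "(u, t) \<in> T\<^sub>0" "s = t + \<i> *\<^sub>C u"
        by (auto simp: shifted_range_def)
      then have "cinner t y = cinner u v"
        using adj T0_subset_T by (auto simp: op_adjoint_def)
      moreover have "cinner t x = cinner u w"
        using ut T0_subset_T xw T_symmetric by blast
      ultimately show ?thesis
        unfolding ut w_def
        by (simp add: cinner_diff_right cinner_add_left cinner_add_right cinner_scaleC_left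
            cinner_scaleC_right algebra_simps)
    qed
    then have "y - x = 0" using orthogonal_dense_eq_0[OF dense(2)] by blast
    then show ?thesis using xw by (simp add: w_def)
  qed
  ultimately have "op_adjoint T = T" by auto
  then show ?thesis
    by (simp add: self_adjoint_def linear_operator_T Domain_T_dense)
qed

section \<open>Truncations in coordinates\<close>

lemma orthogonal_projection_truncation_space:
  "orthogonal_projection (truncation_space e N) y = (\<Sum>k=1..N. cinner y (e k) *\<^sub>C e k)"
  (is "_ = ?y")
proof -
  let ?M = "truncation_space e N"
  have sub: "complex_vector.subspace ?M" by (simp add: truncation_space_def)
  have in_M: "?y \<in> ?M"
    unfolding truncation_space_def
    by (intro complex_vector.span_sum complex_vector.span_scale complex_vector.span_base) auto
  have orth_e: "cinner (y - ?y) (e j) = 0" if "j \<in> {1..N}" for j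
  proof -
    have "cinner ?y (e j) = (\<Sum>k=1..N. if k = j then cinner y (e k) else 0)"
      unfolding cinner_sum_left using that
      by (intro sum.cong) (auto simp: cinner_scaleC_left cinner_e)
    then show ?thesis using that by (simp add: cinner_diff_left)
  qed
  have orth: "cinner (y - ?y) z = 0" if "z \<in> ?M" for z
    using that unfolding truncation_space_def
    by (induction rule: complex_vector.span_induct_alt)
      (use orth_e in \<open>auto simp: cinner_add_right cinner_scaleC_right\<close>)
  show ?thesis
    unfolding orthogonal_projection_def
  proof (rule the_equality)
    fix u assume u: "u \<in> ?M \<and> (\<forall>z\<in>?M. cinner (y - u) z = 0)"
    have d: "u - ?y \<in> ?M" using u in_M by (intro complex_vector.subspace_diff sub) auto
    \<comment> \<open>Uniqueness for the definite description: the difference of two candidates lies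
      in the subspace and is orthogonal to it, hence to itself.\<close>
    have "cinner (u - ?y) (u - ?y) = cinner (y - ?y) (u - ?y) - cinner (y - u) (u - ?y)"
      by (simp add: cinner_diff_left)
    also have "\<dots> = 0" using u d orth by simp
    finally show "u = ?y" by (simp add: cinner_self)
  qed (use in_M orth in blast)
qed

text \<open>A vector of the subspace is its own projection, so the coordinate formula for the
  projection expands it.\<close>

lemma truncation_space_expand:
  assumes "x \<in> truncation_space e N"
  shows "(\<Sum>k=1..N. cinner x (e k) *\<^sub>C e k) = x"
proof -
  have "orthogonal_projection (truncation_space e N) x = x"
    unfolding orthogonal_projection_def
  proof (rule the_equality)
    fix u assume u: "u \<in> truncation_space e N \<and> (\<forall>z\<in>truncation_space e N. cinner (x - u) z = 0)"
    then have "x - u \<in> truncation_space e N"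
      using assms unfolding truncation_space_def by (intro complex_vector.span_diff) auto
    then have "cinner (x - u) (x - u) = 0" using u by blast
    then show "u = x" by (simp add: cinner_self)
  qed (use assms in simp)
  then show ?thesis by (simp add: orthogonal_projection_truncation_space)
qed

text \<open>The coordinate of the eigenvalue equation at \<open>e (Suc n)\<close>. Extending the
  coordinates by 0 on both sides gives the first and the last row the same form as the interior
  ones.\<close>

lemma truncation_eigenvector_rec:
  fixes \<xi> :: "nat \<Rightarrow> complex" and \<mu> :: complex
  assumes x: "x \<in> truncation_space e N" and eig: "truncation e T N x = \<mu> *\<^sub>C x"
    and n: "n < N"
  defines "\<xi> \<equiv> \<lambda>k. if k = 0 \<or> k > N then 0 else cinner x (e k)"
  shows "a (Suc n) * \<xi> (Suc (Suc n)) = (\<mu> - b (Suc n)) * \<xi> (Suc n) - a n * \<xi> n"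
proof -
  have xi: "cinner x (e k) = \<xi> k" if "k \<ge> 1" for k
  proof (cases "k \<le> N")
    case False
    have "cinner x (e k) = (\<Sum>j=1..N. cinner (cinner x (e j) *\<^sub>C e j) (e k))"
      by (subst truncation_space_expand[OF x, symmetric]) (simp add: cinner_sum_left)
    also have "\<dots> = 0"
      using False that by (intro sum.neutral) (auto simp: cinner_scaleC_left cinner_e)
    finally show ?thesis using False by (simp add: \<xi>_def)
  qed (use that in \<open>simp add: \<xi>_def\<close>)
  have "x \<in> Domain T\<^sub>0"
    unfolding Domain_tridiagonal_operator_0
    using x complex_vector.span_mono[of "e ` {1..N}" "e ` {1..}"]
    by (force simp: truncation_space_def)
  then obtain w where w: "(x, w) \<in> T\<^sub>0" by blast
  then have "op_apply T x = w" using T0_subset_T op_apply_T by blast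
  then  have "\<mu> *\<^sub>C x = (\<Sum>k=1..N. cinner w (e k) *\<^sub>C e k)"
    using eig
    by (simp add: truncation_def Let_def orthogonal_projection_truncation_space
        truncation_space_expand[OF x] del: One_nat_def)
  then have "\<mu> * cinner x (e (Suc n)) = cinner (\<Sum>k=1..N. cinner w (e k) *\<^sub>C e k) (e (Suc n))"
    by (metis cinner_scaleC_left)
  also have "\<dots> = (\<Sum>k=1..N. if k = Suc n then cinner w (e k) else 0)"
    unfolding cinner_sum_left by (intro sum.cong) (auto simp: cinner_scaleC_left cinner_e)
  also have "\<dots> = cinner w (e (Suc n))" using n by simp
  \<comment> \<open>Symmetry moves the operator from x to a basis vector, whose image is
    explicit.\<close>
  also have "\<dots> = cinner x (tridiagonal_image e a b (Suc n))"
    by (rule tridiagonal_operator_0_symmetric[OF basis w e_in_T0]) simp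
  also have "\<dots> = a (Suc n) * \<xi> (Suc (Suc n)) + b (Suc n) * \<xi> (Suc n) + a n * \<xi> n"
  proof -
    have R: "cinner x (r *\<^sub>R y) = r * cinner x y" for r y
      using cinner_scaleC_right[of x "complex_of_real r" y] by (simp add: scaleC_of_real)
    show ?thesis
      by (cases "n = 0") (simp_all add: tridiagonal_image_def cinner_add_right R xi, simp add: \<xi>_def)
  qed
  finally show ?thesis by (simp add: xi algebra_simps)
qed

end

section \<open>Convergent series: contradiction with unit eigenvectors\<close>

theorem theorem2p1:
  fixes e :: "nat \<Rightarrow> 'a::complex_hilbert_space"
    and a b :: "nat \<Rightarrow> real"
    and \<N> :: "nat set"
    and x :: "nat \<Rightarrow> 'a"
    and lam :: "nat \<Rightarrow> complex"
  assumes "orthonormal_basis e"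
    and "\<And>n. n \<ge> 1 \<Longrightarrow> a n > 0"
    and "\<N> \<subseteq> {1..}" and "infinite \<N>"
    and "\<And>N. N \<in> \<N> \<Longrightarrow> x N \<in> truncation_space e N"
    and "\<And>N. N \<in> \<N> \<Longrightarrow> norm (x N) = 1"
    and "\<And>N. N \<in> \<N> \<Longrightarrow> truncation e (tridiagonal_operator e a b) N (x N) = lam N *\<^sub>C x N"
    and "bounded (lam ` \<N>)"
    and "((\<lambda>N. complex_of_real (a N) * cinner (x N) (e N)) \<longlongrightarrow> 0)
           (inf sequentially (principal \<N>))"
  shows "self_adjoint (tridiagonal_operator e a b)"
proof -
  interpret tridiagonal e a b
    using assms(1,2) by unfold_locales
  show ?thesis
  proof (rule self_adjoint_T, rule ccontr)
    let ?p = "orthopoly a b \<i>"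
    fix P assume "\<nexists>n. (\<Sum>k=1..n. (cmod (?p k))\<^sup>2) > P"
    then have P: "(\<Sum>k=1..n. (cmod (?p k))\<^sup>2) \<le> P" for n
      by (meson not_le)
    obtain K where K: "\<And>N. N \<in> \<N> \<Longrightarrow> cmod (lam N) \<le> K"
      using assms(8) by (auto simp: bounded_iff)
    \<comment> \<open>The factors of \<open>truncated_eigenvector_bound\<close> that do not depend
      on N.\<close>
    define C where "C = sqrt P * exp ((K + 1) * P)"
    have P1: "P \<ge> 1" using P[of 1] by simp
    then have C0: "C > 0" by (simp add: C_def)
    \<comment> \<open>Summing the squared bounds on the coordinates gives at most (\<epsilon> C sqrt
      P)^2, so this threshold pushes the norm below 1. A single index of the infinite set beyond
      \<open>N\<^sub>0\<close> then suffices.\<close>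
    have "eventually (\<lambda>N. N \<in> \<N> \<longrightarrow> cmod (a N * cinner (x N) (e N)) < 1 / (C * sqrt P)) sequentially"
      using tendstoD[OF assms(9), of "1 / (C * sqrt P)"] C0 P1
      by (simp add: eventually_inf_principal)
    then obtain N\<^sub>0 where N0: "\<And>N. N \<ge> N\<^sub>0 \<Longrightarrow> N \<in> \<N> \<Longrightarrow>
        cmod (a N * cinner (x N) (e N)) < 1 / (C * sqrt P)"
      by (auto simp: eventually_sequentially)
    obtain N where N: "N \<in> \<N>" "N \<ge> N\<^sub>0"
      using \<open>infinite \<N>\<close> by (meson infinite_nat_iff_unbounded_le)
    have N1: "N \<ge> 1" using N assms(3) by auto
    define \<xi> where "\<xi> k = (if k = 0 \<or> k > N then 0 else cinner (x N) (e k))" for k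
    define \<epsilon> where "\<epsilon> = cmod (a N * \<xi> N)"
    have \<epsilon>: "\<epsilon> < 1 / (C * sqrt P)" using N0[OF N(2,1)] N1 by (simp add: \<epsilon>_def \<xi>_def)
    have bound: "cmod (\<xi> k) \<le> cmod (?p k) * (\<epsilon> * C)" if "k \<in> {1..N}" for k
    proof -
      have "cmod (\<xi> k) \<le> cmod (?p k) * (cmod (a N * \<xi> N) * sqrt P * exp ((K + 1) * P))"
      proof (rule truncated_eigenvector_bound[where \<mu> = "lam N" and N = N])
        show "a (Suc n) * \<xi> (Suc (Suc n)) = (lam N - b (Suc n)) * \<xi> (Suc n) - a n * \<xi> n"
          if "n < N" for n
          unfolding \<xi>_def by (rule truncation_eigenvector_rec[OF assms(5,7)[OF N(1)] that])
        show "a n \<noteq> 0" if "n \<ge> 1" for n using assms(2)[OF that] by simp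
      qed (use that P K[OF N(1)] in \<open>auto simp: \<xi>_def\<close>)
      then show ?thesis by (simp add: \<epsilon>_def C_def mult.assoc)
    qed
    have "1 = (norm (\<Sum>k=1..N. cinner (x N) (e k) *\<^sub>C e k))\<^sup>2"
      by (simp add: truncation_space_expand[OF assms(5)[OF N(1)]] assms(6)[OF N(1)] del: One_nat_def)
    also have "\<dots> = (\<Sum>k=1..N. (cmod (\<xi> k))\<^sup>2)"
      unfolding norm_sum_e by (intro sum.cong) (auto simp: \<xi>_def)
    also have "\<dots> \<le> (\<Sum>k=1..N. (cmod (?p k) * (\<epsilon> * C))\<^sup>2)"
      by (intro sum_mono power_mono bound) auto
    also have "\<dots> = (\<Sum>k=1..N. (cmod (?p k))\<^sup>2) * (\<epsilon> * C)\<^sup>2"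
      by (simp only: power_mult_distrib sum_distrib_right)
    also have "\<dots> \<le> P * (\<epsilon> * C)\<^sup>2"
      by (intro mult_right_mono P) simp
    also have "\<dots> = (\<epsilon> * (C * sqrt P))\<^sup>2"
      using P1 by (simp add: power_mult_distrib)
    also have "\<dots> < 1"
    proof -
      have "0 \<le> \<epsilon> * (C * sqrt P)" "\<epsilon> * (C * sqrt P) < 1"
        using \<epsilon> C0 P1 by (auto simp: \<epsilon>_def field_simps)
      then show ?thesis by (simp add: power_less_one_iff)
    qed
    finally show False by simp
  qed
qed

end
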